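(* Any attractor of a continuous multivalued map on a metric space $(X,d)$ is asymptotically stable in $(\mathbb{K}(X),d_H)$. That is, if $F:X\to\mathbb{K}(X)$ is a continuous multivalued map and $A^*\in\mathbb{K}(X)$ is an attractor of $F$, then $A^*$ is an asymptotically stable fixed point of the induced operator $F:\mathbb{K}(X)\to\mathbb{K}(X)$ on the metric space $(\mathbb{K}(X),d_H)$.
   Context: $\mathbb{K}(X)$ denotes the space of (nonempty) compact subsets of the metric space $(X,d)$, endowed with the Hausdorff metric $d_H(A,B)=\max\{\sup_{a\in A}\inf_{b\in B}d(a,b),\ \sup_{b\in B}\inf_{a\in A}d(a,b)\}$. A multivalued map is a map $F:X\to\mathbb{K}(X)$; continuity is with respect to $d$ and $d_H$. It induces the operator $F:\mathbb{K}(X)\to\mathbb{K}(X)$, $F(A)=\bigcup_{x\in A}F(x)$, denoted by the same letter; a continuous multivalued map on a metric space induces a continuous operator. $F^n$ denotes the $n$-th iterate. Attractor: $A^*\in\mathbb{K}(X)$ is an attractor of the continuous multivalued map $F$ if $F(A^* )=A^*$ and there is an open set $U\subset\mathbb{K}(X)$ such that $\lim_{n\to\infty}d_H(F^n(B),A^* )=0$ for all $B\in U$. Asymptotic stability is defined for a continuous self-map $f:Y\to Y$ of a metric space $(Y,\rho)$ with a fixed point $y^*$ (here it is applied with $Y=\mathbb{K}(X)$, $\rho=d_H$, $f$ the induced operator $F$, and $y^*=A^*$). The point $y^*$ is attractive if $\lim_{n\to\infty}\rho(f^n(y),y^* )=0$ for all $y\in Y$. The point $y^*$ is stable if for any $\epsilon>0$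 there exists $\delta>0$ such that $\rho(f^n(y),y^* )<\epsilon$ for all $n\in\mathbb{N}$ and all $y\in Y$ with $\rho(y,y^* )<\delta$. The point $y^*$ is asymptotically stable if it is attractive and stable.
   Formalization: The open set U in the definition of attractor is required to contain A*, and "attractive" is taken relative to such a U instead of all of K(X) (stability is still in all of K(X)); literally the claim fails, e.g. U empty, or x -> {x^2} on the real line with A* = {0}. *)

theory Defs
  imports "HOL-Analysis.Analysis"
begin

typedef (overloaded) ('a :: topological_space) hyperspace = "{A :: 'a set. A \<noteq> {} \<and> compact A}"
  morphisms set_of Hyper
  by (rule exI[of _ "{undefined}"]) simp

lemma set_of_nonempty [simp]: "set_of A \<noteq> {}"
  and compact_set_of [simp]: "compact (set_of A)"
  using set_of[of A] by auto

lemma set_of_Hyper: "A \<noteq> {} \<Longrightarrow> compact A \<Longrightarrow> set_of (Hyper A) = A"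
  by (rule Hyper_inverse) simp

instantiation hyperspace :: (metric_space) metric_space
begin

definition dist_hyperspace :: "'a hyperspace \<Rightarrow> 'a hyperspace \<Rightarrow> real" where
  "dist_hyperspace A B =
     max (SUP a\<in>set_of A. INF b\<in>set_of B. dist a b)
         (SUP b\<in>set_of B. INF a\<in>set_of A. dist a b)"

definition uniformity_hyperspace :: "('a hyperspace \<times> 'a hyperspace) filter" where
  "uniformity_hyperspace = (INF e\<in>{0 <..}. principal {(x, y). dist x y < e})"

definition open_hyperspace :: "'a hyperspace set \<Rightarrow> bool" where
  "open_hyperspace S = (\<forall>x\<in>S. \<forall>\<^sub>F (x', y) in uniformity. x' = x \<longrightarrow> y \<in> S)"

lemma dist_hyperspace_infdist:
  "dist A B = max (SUP a\<in>set_of A. infdist a (set_of B)) (SUP b\<in>set_of B. infdist b (set_of A))"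
  for A B :: "'a hyperspace"
  by (simp add: dist_hyperspace_def infdist_notempty dist_commute)

lemma bdd_above_infdist_set_of: "bdd_above ((\<lambda>a. infdist a (set_of B)) ` set_of A)"
  for A B :: "'a hyperspace"
  by (intro bounded_imp_bdd_above compact_imp_bounded compact_continuous_image
      continuous_intros compact_set_of)

lemma infdist_le_dist_hyperspace:
  fixes A B :: "'a hyperspace"
  shows "a \<in> set_of A \<Longrightarrow> infdist a (set_of B) \<le> dist A B"
    and "b \<in> set_of B \<Longrightarrow> infdist b (set_of A) \<le> dist A B"
  unfolding dist_hyperspace_infdist
  by (rule max.coboundedI1 max.coboundedI2, erule cSUP_upper[OF _ bdd_above_infdist_set_of])+

lemma dist_hyperspace_le:
  fixes A B :: "'a hyperspace"
  assumes "\<And>a. a \<in> set_of A \<Longrightarrow> infdist a (set_of B) \<le> e"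
    and "\<And>b. b \<in> set_of B \<Longrightarrow> infdist b (set_of A) \<le> e"
  shows "dist A B \<le> e"
  unfolding dist_hyperspace_infdist using assms by (auto intro!: cSUP_least)

instance
proof
  fix A B C :: "'a hyperspace"
  show "dist A B = 0 \<longleftrightarrow> A = B"
  proof
    assume *: "dist A B = 0"
    have "infdist a (set_of B) = 0" if "a \<in> set_of A" for a
      using infdist_le_dist_hyperspace(1)[OF that, of B] infdist_nonneg[of a "set_of B"] * by simp
    moreover have "infdist b (set_of A) = 0" if "b \<in> set_of B" for b
      using infdist_le_dist_hyperspace(2)[OF that, of A] infdist_nonneg[of b "set_of A"] * by simp
    ultimately have "set_of A = set_of B"
      by (meson compact_imp_closed compact_set_of in_closed_iff_infdist_zero set_of_nonempty
          subsetI subset_antisym)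
    then show "A = B"
      by (simp add: set_of_inject)
  next
    assume "A = B"
    then show "dist A B = 0"
      by (simp add: dist_hyperspace_infdist cong: SUP_cong_simp)
  qed
  have aux: "infdist a (set_of B) \<le> infdist a (set_of C) + d"
    if d: "\<And>c. c \<in> set_of C \<Longrightarrow> infdist c (set_of B) \<le> d" for a d and B C :: "'a hyperspace"
  proof -
    have "infdist a (set_of B) - d \<le> infdist a (set_of C)"
      unfolding infdist_notempty[OF set_of_nonempty[of C]]
    proof (rule cINF_greatest)
      fix c assume "c \<in> set_of C"
      then show "infdist a (set_of B) - d \<le> dist a c"
        using d[of c] infdist_triangle[of a "set_of B" c] by simp
    qed simp
    then show ?thesis by simp
  qed
  show "dist A B \<le> dist A C + dist B C"
  proof (rule dist_hyperspace_le)
    fix a assume "a \<in> set_of A"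
    then show "infdist a (set_of B) \<le> dist A C + dist B C"
      using aux[of C B "dist B C" a] infdist_le_dist_hyperspace(1)[of a A C]
        infdist_le_dist_hyperspace(2)[of _ C B] by fastforce
  next
    fix b assume "b \<in> set_of B"
    then show "infdist b (set_of A) \<le> dist A C + dist B C"
      using aux[of C A "dist A C" b] infdist_le_dist_hyperspace(1)[of b B C]
        infdist_le_dist_hyperspace(2)[of _ C A] by fastforce
  qed
qed (simp_all add: uniformity_hyperspace_def open_hyperspace_def)

end

lemma dist_hyperspace_lessD:
  fixes A B :: "'a :: metric_space hyperspace"
  assumes "dist A B < e" "a \<in> set_of A"
  shows "\<exists>b\<in>set_of B. dist a b < e"
proof -
  have "(INF b\<in>set_of B. dist a b) < e"
    using infdist_le_dist_hyperspace(1)[OF assms(2), of B] assms(1)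
    by (simp add: infdist_notempty)
  then show ?thesis
    by (subst (asm) cINF_less_iff) auto
qed

lemma dist_tendsto_0_le:
  fixes f g :: "nat \<Rightarrow> 'a :: metric_space"
  assumes "h \<longlonglongrightarrow> 0" "\<And>n. dist (f n) (g n) \<le> h n"
  shows "(\<lambda>n. dist (f n) (g n)) \<longlonglongrightarrow> 0"
  by (rule tendsto_sandwich[OF always_eventually always_eventually tendsto_const assms(1)])
    (simp_all add: assms(2))


text \<open>\<^term>\<open>Hyper\<close> is unspecified on sets that are not nonempty and compact;
  for continuous \<open>F\<close> the union below is always compact (see \<open>set_of_induced\<close>).\<close>

definition induced :: "('a :: metric_space \<Rightarrow> 'a hyperspace) \<Rightarrow> 'a hyperspace \<Rightarrow> 'a hyperspace" where
  "induced F A = Hyper (\<Union>x\<in>set_of A. set_of (F x))"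

lemma set_of_induced:
  fixes F :: "'a :: metric_space \<Rightarrow> 'a hyperspace"
  assumes F: "continuous_on UNIV F"
  shows "set_of (induced F A) = (\<Union>x\<in>set_of A. set_of (F x))"
proof -
  have "seq_compact (\<Union>x\<in>set_of A. set_of (F x))"
  proof (rule seq_compactI)
    fix y :: "nat \<Rightarrow> 'a"
    assume "\<forall>n. y n \<in> (\<Union>x\<in>set_of A. set_of (F x))"
    then obtain x where x: "\<And>n. x n \<in> set_of A" "\<And>n. y n \<in> set_of (F (x n))"
      by (metis UN_iff)
    obtain l r where l: "l \<in> set_of A" "strict_mono r" "(x \<circ> r) \<longlonglongrightarrow> l"
      using x(1) compact_set_of[of A] unfolding compact_def by metis
    have Fl: "(\<lambda>n. dist (F (x (r n))) (F l)) \<longlonglongrightarrow> 0"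
      using continuous_on_tendsto_compose[OF F l(3)] by (simp add: tendsto_dist_iff[symmetric] o_def)
    have "\<exists>z\<in>set_of (F l). dist (y (r n)) z < dist (F (x (r n))) (F l) + 1 / Suc n" for n
      by (rule dist_hyperspace_lessD[OF _ x(2)]) simp
    then obtain z where z: "\<And>n. z n \<in> set_of (F l)"
      "\<And>n. dist (y (r n)) (z n) < dist (F (x (r n))) (F l) + 1 / Suc n"
      by metis
    obtain m s where m: "m \<in> set_of (F l)" "strict_mono s" "(z \<circ> s) \<longlonglongrightarrow> m"
      using z(1) compact_set_of[of "F l"] unfolding compact_def by metis
    have "(\<lambda>n. dist (F (x (r n))) (F l) + 1 / Suc n) \<longlonglongrightarrow> 0 + 0"
      by (intro tendsto_add Fl LIMSEQ_Suc[OF lim_1_over_n])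
    then have "(\<lambda>n. dist (y (r n)) (z n)) \<longlonglongrightarrow> 0"
      by (intro dist_tendsto_0_le[OF _ less_imp_le[OF z(2)]]) simp
    from LIMSEQ_subseq_LIMSEQ[OF this m(2)]
    have "(\<lambda>n. dist (y (r (s n))) (z (s n)) + dist (z (s n)) m) \<longlonglongrightarrow> 0 + 0"
      using m(3) by (intro tendsto_add) (simp_all add: tendsto_dist_iff[symmetric] o_def)
    then have "(\<lambda>n. dist (y (r (s n))) m) \<longlonglongrightarrow> 0"
      by (intro dist_tendsto_0_le[OF _ dist_triangle]) simp
    then have "(y \<circ> (r \<circ> s)) \<longlonglongrightarrow> m"
      by (simp add: tendsto_dist_iff[symmetric] o_def)
    then show "\<exists>m\<in>\<Union>x\<in>set_of A. set_of (F x). \<exists>t. strict_mono t \<and> (y \<circ> t) \<longlonglongrightarrow> m"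
      using m(1) l(1) strict_mono_o[OF l(2) m(2)] by blast
  qed
  then show ?thesis
    unfolding induced_def by (subst set_of_Hyper) (auto simp: compact_eq_seq_compact_metric)
qed

lemma continuous_on_induced:
  fixes F :: "'a :: metric_space \<Rightarrow> 'a hyperspace"
  assumes F: "continuous_on UNIV F"
  shows "continuous_on UNIV (induced F)"
proof -
  have "\<exists>d>0. \<forall>B. dist B A < d \<longrightarrow> dist (induced F B) (induced F A) \<le> e"
    if "e > 0" for A :: "'a hyperspace" and e :: real
  proof -
    have "\<exists>d>0. \<forall>a\<in>set_of A. \<forall>b. dist b a < d \<longrightarrow> dist (F b) (F a) < e"
    proof (rule ccontr)
      assume "\<not> ?thesis"
      then have "\<exists>a\<in>set_of A. \<exists>b. dist b a < 1 / Suc n \<and> \<not> dist (F b) (F a) < e" for n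
        by (metis of_nat_0_less_iff zero_less_Suc zero_less_divide_1_iff)
      then obtain a b where ab: "\<And>n. a n \<in> set_of A" "\<And>n. dist (b n) (a n) < 1 / Suc n"
        "\<And>n. \<not> dist (F (b n)) (F (a n)) < e"
        by metis
      obtain l r where l: "l \<in> set_of A" "strict_mono r" "(a \<circ> r) \<longlonglongrightarrow> l"
        using ab(1) compact_set_of[of A] unfolding compact_def by metis
      have "(\<lambda>n. dist (b n) (a n)) \<longlonglongrightarrow> 0"
        by (rule dist_tendsto_0_le[OF LIMSEQ_Suc[OF lim_1_over_n] less_imp_le[OF ab(2)]])
      from LIMSEQ_subseq_LIMSEQ[OF this l(2)]
      have "(\<lambda>n. dist (b (r n)) (a (r n)) + dist (a (r n)) l) \<longlonglongrightarrow> 0 + 0"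
        using l(3) by (intro tendsto_add) (simp_all add: tendsto_dist_iff[symmetric] o_def)
      then have "(\<lambda>n. dist (b (r n)) l) \<longlonglongrightarrow> 0"
        by (intro dist_tendsto_0_le[OF _ dist_triangle]) simp
      then have "(\<lambda>n. F (b (r n))) \<longlonglongrightarrow> F l"
        by (intro continuous_on_tendsto_compose[OF F]) (simp_all add: tendsto_dist_iff[symmetric])
      moreover have "(\<lambda>n. F (a (r n))) \<longlonglongrightarrow> F l"
        using continuous_on_tendsto_compose[OF F l(3)] by (simp add: o_def)
      ultimately have "(\<lambda>n. dist (F (b (r n))) (F (a (r n)))) \<longlonglongrightarrow> dist (F l) (F l)"
        by (rule tendsto_dist)
      then have "\<forall>\<^sub>F n in sequentially. dist (F (b (r n))) (F (a (r n))) < e"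
        using \<open>e > 0\<close> by (intro order_tendstoD) auto
      then show False
        using ab(3) by simp
    qed
    then obtain d where d: "d > 0" "\<And>a b. a \<in> set_of A \<Longrightarrow> dist b a < d \<Longrightarrow> dist (F b) (F a) < e"
      by blast
    have "dist (induced F B) (induced F A) \<le> e" if B: "dist B A < d" for B
    proof (rule dist_hyperspace_le)
      fix y assume "y \<in> set_of (induced F B)"
      then obtain b where b: "b \<in> set_of B" "y \<in> set_of (F b)"
        by (auto simp: set_of_induced[OF F])
      obtain a where a: "a \<in> set_of A" "dist b a < d"
        using dist_hyperspace_lessD[OF B b(1)] by blast
      obtain z where "z \<in> set_of (F a)" "dist y z < e"
        using dist_hyperspace_lessD[OF d(2)[OF a] b(2)] by blast
      then show "infdist y (set_of (induced F A)) \<le> e"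
        using a(1) by (intro infdist_le2[of z]) (auto simp: set_of_induced[OF F])
    next
      fix y assume "y \<in> set_of (induced F A)"
      then obtain a where a: "a \<in> set_of A" "y \<in> set_of (F a)"
        by (auto simp: set_of_induced[OF F])
      obtain b where b: "b \<in> set_of B" "dist a b < d"
        using dist_hyperspace_lessD[OF _ a(1), of B d] B by (auto simp: dist_commute)
      have "dist (F a) (F b) < e"
        using d(2)[OF a(1), of b] b(2) by (simp add: dist_commute)
      then obtain z where "z \<in> set_of (F b)" "dist y z < e"
        using dist_hyperspace_lessD[OF _ a(2)] by blast
      then show "infdist y (set_of (induced F B)) \<le> e"
        using b(1) by (intro infdist_le2[of z]) (auto simp: set_of_induced[OF F])
    qed
    with d(1) show ?thesis by blast
  qed
  note le = this
  show ?thesis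
    unfolding continuous_on_iff
  proof (intro ballI allI impI)
    fix A :: "'a hyperspace" and e :: real
    assume "e > 0"
    then obtain d where "d > 0"
      "\<And>B. dist B A < d \<Longrightarrow> dist (induced F B) (induced F A) \<le> e / 2"
      using le[of "e / 2" A] by auto
    with \<open>e > 0\<close>
    show "\<exists>d>0. \<forall>B\<in>UNIV. dist B A < d \<longrightarrow> dist (induced F B) (induced F A) < e"
      by (intro exI[of _ d]) (fastforce intro: order_le_less_trans)
  qed
qed


text \<open>The open set \<open>U\<close> is a neighbourhood of the attractor. Without \<open>A \<in> U\<close>
  (for instance with \<open>U = {}\<close>) an unstable fixed point would qualify.\<close>

definition attractor_on ::
    "'a hyperspace set \<Rightarrow> ('a :: metric_space \<Rightarrow> 'a hyperspace) \<Rightarrow> 'a hyperspace \<Rightarrow> bool" where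
  "attractor_on U F A \<longleftrightarrow>
     open U \<and> A \<in> U \<and> induced F A = A \<and>
     (\<forall>B\<in>U. (\<lambda>n. dist ((induced F ^^ n) B) A) \<longlonglongrightarrow> 0)"

definition attractor :: "('a :: metric_space \<Rightarrow> 'a hyperspace) \<Rightarrow> 'a hyperspace \<Rightarrow> bool" where
  "attractor F A \<longleftrightarrow> (\<exists>U. attractor_on U F A)"

definition attractive_on :: "'b set \<Rightarrow> ('b :: metric_space \<Rightarrow> 'b) \<Rightarrow> 'b \<Rightarrow> bool" where
  "attractive_on U f p \<longleftrightarrow> (\<forall>y\<in>U. (\<lambda>n. dist ((f ^^ n) y) p) \<longlonglongrightarrow> 0)"

definition stable :: "('b :: metric_space \<Rightarrow> 'b) \<Rightarrow> 'b \<Rightarrow> bool" where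
  "stable f p \<longleftrightarrow> (\<forall>e>0. \<exists>d>0. \<forall>n. \<forall>y. dist y p < d \<longrightarrow> dist ((f ^^ n) y) p < e)"

text \<open>With \<open>U = UNIV\<close> this is global asymptotic stability. As an attractor need only attract
  the members of a neighbourhood, e.g. \<open>{0}\<close> under \<open>x \<mapsto> {x\<^sup>2}\<close> on the real line,
  attractivity is taken relative to \<open>U\<close>; stability always refers to the whole space.\<close>

definition asymptotically_stable_on :: "'b set \<Rightarrow> ('b :: metric_space \<Rightarrow> 'b) \<Rightarrow> 'b \<Rightarrow> bool" where
  "asymptotically_stable_on U f p \<longleftrightarrow> f p = p \<and> attractive_on U f p \<and> stable f p"

definition asymptotically_stable :: "('b :: metric_space \<Rightarrow> 'b) \<Rightarrow> 'b \<Rightarrow> bool" where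
  "asymptotically_stable f p \<longleftrightarrow> (\<exists>U. open U \<and> p \<in> U \<and> asymptotically_stable_on U f p)"

end

theory Submission
  imports Defs
begin

text \<open>
  Attraction alone does not imply stability for a continuous map of a metric space: an orbit may
  make a long excursion before it returns. What excludes this for the operator \<open>f\<close> induced by a
  multivalued map is that \<open>f\<close> is monotone for inclusion. Monotonicity is used from both sides,
  since the Hausdorff distance of \<open>f\<^sup>n(B)\<close> and the attractor \<open>A\<close> has two halves.

  \<^emph>\<open>From above\<close> (\<open>outer_stable\<close>). If \<open>B\<^sub>k \<rightarrow> A\<close>, then \<open>A\<close> together with all the late
  \<open>B\<^sub>k\<close> is one compact set \<open>C\<close> near \<open>A\<close>. As \<open>f\<^sup>n(B\<^sub>k) \<subseteq> f\<^sup>n(C) \<rightarrow> A\<close>, the sets \<open>f\<^sup>n(B\<^sub>k)\<close> lie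
  in a small neighbourhood of \<open>A\<close> for all \<open>n \<ge> N\<close>, with \<open>N\<close> independent of \<open>k\<close>; the finitely many
  smaller \<open>n\<close> are handled by continuity.

  \<^emph>\<open>From below, for subsets of \<open>A\<close>\<close> (\<open>inner_stable\<close>). The hyperspace of \<open>A\<close> is compact
  (\<open>compact_hyperspace_within\<close>), so by Baire's theorem attraction is uniform on some small ball
  around some \<open>B\<^sub>0 \<subseteq> A\<close> (\<open>uniform_on_small_ball\<close>). This ball may be far from \<open>A\<close>, but every
  \<open>B \<subseteq> A\<close> close to \<open>A\<close> contains some \<open>K\<close> close to \<open>B\<^sub>0\<close>, and
  \<open>f\<^sup>n(K) \<subseteq> f\<^sup>n(B) \<subseteq> A\<close> forces \<open>f\<^sup>n(B)\<close> to be at least as close to \<open>A\<close> as \<open>f\<^sup>n(K)\<close>.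
  Hence \<open>A\<close> is stable in its own hyperspace, and by compactness a small closed ball there returns
  into its interior after some fixed number \<open>N\<close> of steps (\<open>uniform_return\<close>).

  \<^emph>\<open>Combination\<close> (\<open>stable_fixed_point\<close>). If \<open>A\<close> were unstable, there would be \<open>B\<^sub>k \<rightarrow> A\<close> whose orbits
  leave a fixed ball around \<open>A\<close>, for the first time at step \<open>m\<^sub>k\<close>. By stability from above their
  iterates at step \<open>m\<^sub>k - N\<close> subconverge to some \<open>L \<subseteq> A\<close> in the closed ball whose image
  \<open>f\<^sup>N(L)\<close> is not inside the ball, against uniform return.
\<close>

section \<open>One-sided Hausdorff distance\<close>

lemma dist_hyperspace_lessD':
  fixes A B :: "'a :: metric_space hyperspace"
  assumes "dist A B < e" "b \<in> set_of B"
  obtains a where "a \<in> set_of A" "dist b a < e"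
  using dist_hyperspace_lessD[of B A e b] assms by (auto simp: dist_commute)

text \<open>Among subsets of \<open>A\<close> only the failure to fill \<open>A\<close> contributes to the distance from \<open>A\<close>,
  so larger subsets are closer.\<close>

lemma dist_hyperspace_antimono:
  fixes A B C :: "'a :: metric_space hyperspace"
  assumes "set_of B \<subseteq> set_of C" "set_of C \<subseteq> set_of A"
  shows "dist C A \<le> dist B A"
proof (rule dist_hyperspace_le)
  fix c assume "c \<in> set_of C"
  then show "infdist c (set_of A) \<le> dist B A"
    using assms by (auto intro: order_trans[OF infdist_le2[of c]])
next
  fix a assume "a \<in> set_of A"
  have "infdist a (set_of C) \<le> infdist a (set_of B)"
    using assms by (intro infdist_mono) auto
  also have "\<dots> \<le> dist B A"
    by (rule infdist_le_dist_hyperspace) fact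
  finally show "infdist a (set_of C) \<le> dist B A" .
qed

text \<open>A set that lies in the \<open>e\<close>-neighbourhood of \<open>A\<close> need not be close to \<open>A\<close>, but it is close to
  a subset of \<open>A\<close>: collect the points of \<open>A\<close> that are within distance \<open>e\<close> of it. One \<open>C\<close> serves
  all \<open>e\<close>, because it is built for the smallest possible value.\<close>

lemma shadow_in_superset:
  fixes A D :: "'a :: metric_space hyperspace"
  obtains C where "set_of C \<subseteq> set_of A"
    "\<And>e. (\<And>d. d \<in> set_of D \<Longrightarrow> infdist d (set_of A) \<le> e) \<Longrightarrow> dist D C \<le> e"
proof -
  define s where "s = (SUP d\<in>set_of D. infdist d (set_of A))"
  define K where "K = {a \<in> set_of A. infdist a (set_of D) \<le> s}"
  have nearest: "\<exists>a\<in>K. dist d a \<le> s" if d: "d \<in> set_of D" for d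
  proof -
    obtain a where a: "a \<in> set_of A" "\<And>b. b \<in> set_of A \<Longrightarrow> dist d a \<le> dist d b"
      using continuous_attains_inf[OF compact_set_of set_of_nonempty, of A "dist d"]
        continuous_on_dist[OF continuous_on_const continuous_on_id] by blast
    have "dist d a \<le> infdist d (set_of A)"
      unfolding infdist_notempty[OF set_of_nonempty] using a(2) by (intro cINF_greatest) auto
    also have "\<dots> \<le> s"
      unfolding s_def using cSUP_upper[OF d bdd_above_infdist_set_of[of A D]] by simp
    finally have "dist d a \<le> s" .
    moreover from this have "infdist a (set_of D) \<le> s"
      using d by (auto intro: infdist_le2 simp: dist_commute)
    ultimately show ?thesis
      using a(1) by (auto simp: K_def)
  qed
  have "closed {a. infdist a (set_of D) \<le> s}"
    by (intro closed_Collect_le continuous_intros)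
  then have "compact K"
    unfolding K_def Collect_conj_eq by auto
  moreover have "K \<noteq> {}"
    using nearest set_of_nonempty[of D] by blast
  ultimately have K: "set_of (Hyper K) = K"
    by (intro set_of_Hyper)
  show thesis
  proof (rule that[of "Hyper K"])
    show "set_of (Hyper K) \<subseteq> set_of A"
      unfolding K by (auto simp: K_def)
  next
    fix e assume e: "\<And>d. d \<in> set_of D \<Longrightarrow> infdist d (set_of A) \<le> e"
    then have "s \<le> e"
      unfolding s_def by (intro cSUP_least) auto
    have "dist D (Hyper K) \<le> s"
    proof (rule dist_hyperspace_le)
      fix d assume "d \<in> set_of D"
      with nearest show "infdist d (set_of (Hyper K)) \<le> s"
        unfolding K using infdist_le2 by metis
    next
      fix a assume "a \<in> set_of (Hyper K)"
      then show "infdist a (set_of D) \<le> s"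
        unfolding K by (simp add: K_def)
    qed
    with \<open>s \<le> e\<close> show "dist D (Hyper K) \<le> e"
      by simp
  qed
qed

section \<open>Compactness in hyperspaces\<close>

lemma compact_subsequenceE:
  fixes S :: "'a :: metric_space set" and f :: "nat \<Rightarrow> 'a"
  assumes "compact S" "\<And>n. f n \<in> S"
  obtains l r where "l \<in> S" "strict_mono r" "(f \<circ> r) \<longlonglongrightarrow> l"
  using seq_compactE[of S f] assms by (auto simp: compact_eq_seq_compact_metric)

text \<open>Points of members \<open>C\<^sub>n\<close> are tracked, along a subsequence with \<open>C\<^sub>n \<rightarrow> L\<close>, by points of the
  single compact set \<open>L\<close>.\<close>

lemma compact_Union_hyperspace:
  fixes \<C> :: "'a :: metric_space hyperspace set"
  assumes "compact \<C>"
  shows "compact (\<Union>C\<in>\<C>. set_of C)"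
  unfolding compact_eq_seq_compact_metric
proof (rule seq_compactI)
  fix y :: "nat \<Rightarrow> 'a"
  assume "\<forall>n. y n \<in> (\<Union>C\<in>\<C>. set_of C)"
  then have "\<forall>n. \<exists>C. C \<in> \<C> \<and> y n \<in> set_of C" by blast
  then obtain C where C: "\<And>n. C n \<in> \<C>" "\<And>n. y n \<in> set_of (C n)"
    by metis
  obtain L r where L: "L \<in> \<C>" "strict_mono r" "(C \<circ> r) \<longlonglongrightarrow> L"
    by (rule compact_subsequenceE[OF assms C(1)])
  have CL: "(\<lambda>n. dist (C (r n)) L) \<longlonglongrightarrow> 0"
    using L(3) by (simp add: tendsto_dist_iff[symmetric] o_def)
  have "\<exists>z\<in>set_of L. dist (y (r n)) z < dist (C (r n)) L + 1 / Suc n" for n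
    by (rule dist_hyperspace_lessD[OF _ C(2)]) simp
  then obtain z where z: "\<And>n. z n \<in> set_of L"
    "\<And>n. dist (y (r n)) (z n) < dist (C (r n)) L + 1 / Suc n"
    by metis
  have "(\<lambda>n. dist (C (r n)) L + 1 / Suc n) \<longlonglongrightarrow> 0 + 0"
    by (intro tendsto_add CL LIMSEQ_Suc[OF lim_1_over_n])
  then have yz: "(\<lambda>n. dist (y (r n)) (z n)) \<longlonglongrightarrow> 0"
    by (intro dist_tendsto_0_le[OF _ less_imp_le[OF z(2)]]) simp
  obtain m s where m: "m \<in> set_of L" "strict_mono s" "(z \<circ> s) \<longlonglongrightarrow> m"
    by (rule compact_subsequenceE[OF compact_set_of z(1)])
  from LIMSEQ_subseq_LIMSEQ[OF yz m(2)]
  have "(\<lambda>n. dist (y (r (s n))) (z (s n)) + dist (z (s n)) m) \<longlonglongrightarrow> 0 + 0"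
    using m(3) by (intro tendsto_add) (simp_all add: tendsto_dist_iff[symmetric] o_def)
  then have "(\<lambda>n. dist (y (r (s n))) m) \<longlonglongrightarrow> 0"
    by (intro dist_tendsto_0_le[OF _ dist_triangle]) simp
  then have "(y \<circ> (r \<circ> s)) \<longlonglongrightarrow> m"
    by (simp add: tendsto_dist_iff[symmetric] o_def)
  then show "\<exists>m\<in>\<Union>C\<in>\<C>. set_of C. \<exists>t. strict_mono t \<and> (y \<circ> t) \<longlonglongrightarrow> m"
    using m(1) L(1) strict_mono_o[OF L(2) m(2)] by blast
qed

text \<open>The limit of a Cauchy sequence of sets is its topological upper limit, the set of cluster
  points of sequences chosen from it. Compactness of \<open>K\<close> provides enough cluster points.\<close>

lemma complete_hyperspace_within:
  fixes K :: "'a :: metric_space set"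
  assumes K: "compact K"
  shows "complete {B. set_of B \<subseteq> K}"
proof (rule completeI)
  fix B :: "nat \<Rightarrow> 'a hyperspace"
  assume "\<forall>n. B n \<in> {B. set_of B \<subseteq> K}" and "Cauchy B"
  then have BK: "set_of (B n) \<subseteq> K" for n by auto
  define L where "L = (\<Inter>n. closure (\<Union>k\<in>{n..}. set_of (B k)))"
  have clK: "closure (\<Union>k\<in>{n..}. set_of (B k)) \<subseteq> K" for n
    using BK compact_imp_closed[OF K] by (intro closure_minimal) auto
  \<comment> \<open>Choosing \<open>y k\<close> from each \<open>B k\<close> near \<open>x\<close> yields a point of \<open>L\<close> near \<open>x\<close>.\<close>
  have cluster: "\<exists>l\<in>L. dist x l \<le> e"
    if y: "\<And>k. k \<ge> N \<Longrightarrow> y k \<in> set_of (B k)" "\<And>k. k \<ge> N \<Longrightarrow> dist x (y k) \<le> e" for x y e N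
  proof -
    have "y (k + N) \<in> K" for k using y(1)[of "k + N"] BK by auto
    then obtain l r where l: "l \<in> K" "strict_mono r" "((\<lambda>k. y (k + N)) \<circ> r) \<longlonglongrightarrow> l"
      by (rule compact_subsequenceE[OF K])
    have "l \<in> closure (\<Union>k\<in>{n..}. set_of (B k))" for n
    proof (rule Lim_in_closed_set[OF closed_closure _ sequentially_bot l(3)])
      have "\<forall>\<^sub>F i in sequentially. i \<ge> n" by (rule eventually_ge_at_top)
      then show "\<forall>\<^sub>F i in sequentially. ((\<lambda>k. y (k + N)) \<circ> r) i \<in> closure (\<Union>k\<in>{n..}. set_of (B k))"
      proof eventually_elim
        case (elim i)
        then have "n \<le> r i + N" using seq_suble[OF l(2), of i] by simp
        then show ?case
          using y(1)[of "r i + N"] by (intro subsetD[OF closure_subset]) auto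
      qed
    qed
    moreover have "dist x l \<le> e"
      by (rule tendsto_upperbound[OF tendsto_dist[OF tendsto_const l(3)]]) (auto simp: y(2))
    ultimately show ?thesis by (auto simp: L_def)
  qed
  have near: "\<exists>N. \<forall>n\<ge>N. (\<forall>b\<in>set_of (B n). \<exists>l\<in>L. dist b l \<le> e) \<and>
      (\<forall>l\<in>L. infdist l (set_of (B n)) \<le> e)" if "e > 0" for e
  proof -
    obtain N where N: "\<And>m n. m \<ge> N \<Longrightarrow> n \<ge> N \<Longrightarrow> dist (B m) (B n) < e / 2"
      using \<open>Cauchy B\<close> \<open>e > 0\<close> unfolding Cauchy_def by (meson half_gt_zero)
    have "\<exists>l\<in>L. dist b l \<le> e" if "n \<ge> N" "b \<in> set_of (B n)" for n b
    proof -
      have "\<forall>k. \<exists>c. k \<ge> N \<longrightarrow> c \<in> set_of (B k) \<and> dist b c < e / 2"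
        using dist_hyperspace_lessD[OF N that(2)] that(1) by blast
      then obtain y where "\<And>k. k \<ge> N \<Longrightarrow> y k \<in> set_of (B k)" "\<And>k. k \<ge> N \<Longrightarrow> dist b (y k) < e / 2"
        by metis
      then show ?thesis
        using \<open>e > 0\<close> by (intro cluster[of N y]) fastforce+
    qed
    moreover have "infdist l (set_of (B n)) \<le> e" if n: "n \<ge> N" and l: "l \<in> L" for n l
    proof -
      have "l \<in> closure (\<Union>k\<in>{N..}. set_of (B k))" using l by (auto simp: L_def)
      then obtain k c where k: "k \<ge> N" "c \<in> set_of (B k)" "dist c l < e / 2"
        using \<open>e > 0\<close> unfolding closure_approachable by (metis UN_E atLeast_iff half_gt_zero)
      obtain b where "b \<in> set_of (B n)" "dist c b < e / 2"
        using dist_hyperspace_lessD[OF N[OF k(1) n] k(2)] by blast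
      then show ?thesis
        using k(3) dist_triangle_half_r[of c l e b] by (intro infdist_le2[of b]) (auto intro: less_imp_le)
    qed
    ultimately show ?thesis by blast
  qed
  have "closed L" by (auto simp: L_def)
  moreover have "L \<subseteq> K" using clK by (auto simp: L_def)
  ultimately have "compact L" using K compact_Int_closed[of K L] by (simp add: Int_absorb1)
  moreover have "L \<noteq> {}" using near[of 1] set_of_nonempty by (metis all_not_in_conv order_refl zero_less_one)
  ultimately have L: "set_of (Hyper L) = L" by (intro set_of_Hyper)
  have "B \<longlonglongrightarrow> Hyper L"
  proof (rule metric_LIMSEQ_I)
    fix e :: real assume "e > 0"
    then obtain N where N: "\<And>n b. n \<ge> N \<Longrightarrow> b \<in> set_of (B n) \<Longrightarrow> \<exists>l\<in>L. dist b l \<le> e / 2"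
       "\<And>n l. n \<ge> N \<Longrightarrow> l \<in> L \<Longrightarrow> infdist l (set_of (B n)) \<le> e / 2"
      using near[of "e / 2"] by auto
    have "dist (B n) (Hyper L) \<le> e / 2" if n: "n \<ge> N" for n
    proof (rule dist_hyperspace_le)
      fix b assume "b \<in> set_of (B n)"
      then obtain l where "l \<in> L" "dist b l \<le> e / 2" using N(1)[OF n] by blast
      then show "infdist b (set_of (Hyper L)) \<le> e / 2" unfolding L by (rule infdist_le2)
    qed (use N(2)[OF n] L in simp)
    then show "\<exists>N. \<forall>n\<ge>N. dist (B n) (Hyper L) < e"
      using \<open>e > 0\<close> by (intro exI[of _ N]) (fastforce intro: order_le_less_trans)
  qed
  moreover have "Hyper L \<in> {B. set_of B \<subseteq> K}" using L \<open>L \<subseteq> K\<close> by simp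
  ultimately show "\<exists>l\<in>{B. set_of B \<subseteq> K}. B \<longlonglongrightarrow> l" by blast
qed

text \<open>Given completeness, it remains to cover by finitely many balls: their centres are the
  subsets of a finite net of \<open>K\<close>.\<close>

lemma compact_hyperspace_within:
  fixes K :: "'a :: metric_space set"
  assumes K: "compact K"
  shows "compact {B. set_of B \<subseteq> K}"
  unfolding compact_eq_totally_bounded
proof (intro conjI allI impI)
  show "complete {B. set_of B \<subseteq> K}" by (rule complete_hyperspace_within[OF K])
next
  fix e :: real assume "e > 0"
  then obtain P where P: "finite P" "K \<subseteq> (\<Union>p\<in>P. ball p (e / 2))"
    using K unfolding compact_eq_totally_bounded by (meson half_gt_zero)
  have "B \<in> (\<Union>C\<in>Hyper ` Pow P. ball C e)" if B: "set_of B \<subseteq> K" for B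
  proof -
    define Q where "Q = {p \<in> P. \<exists>b\<in>set_of B. dist p b < e / 2}"
    have Q: "\<exists>q\<in>Q. dist b q < e / 2" if "b \<in> set_of B" for b
      using P(2) B that by (fastforce simp: Q_def dist_commute)
    have "finite Q" using P(1) by (simp add: Q_def)
    moreover have "Q \<noteq> {}" using Q set_of_nonempty[of B] by blast
    ultimately have HQ: "set_of (Hyper Q) = Q" by (intro set_of_Hyper finite_imp_compact)
    have "dist (Hyper Q) B \<le> e / 2"
    proof (rule dist_hyperspace_le)
      fix q assume "q \<in> set_of (Hyper Q)"
      then obtain b where "b \<in> set_of B" "dist q b < e / 2" unfolding HQ by (auto simp: Q_def)
      then show "infdist q (set_of B) \<le> e / 2" by (intro infdist_le2[of b]) auto
    next
      fix b assume "b \<in> set_of B"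
      then obtain q where "q \<in> Q" "dist b q < e / 2" using Q by blast
      then show "infdist b (set_of (Hyper Q)) \<le> e / 2" unfolding HQ by (intro infdist_le2[of q]) auto
    qed
    moreover have "Q \<in> Pow P" by (auto simp: Q_def)
    ultimately show ?thesis using \<open>e > 0\<close> by (auto intro!: bexI[of _ Q])
  qed
  then show "\<exists>k. finite k \<and> {B. set_of B \<subseteq> K} \<subseteq> (\<Union>x\<in>k. ball x e)"
    using P(1) by (intro exI[of _ "Hyper ` Pow P"]) auto
qed

section \<open>Iterates of the induced operator\<close>

lemma continuous_on_funpow:
  fixes f :: "'a :: topological_space \<Rightarrow> 'a"
  assumes "continuous_on UNIV f"
  shows "continuous_on UNIV (f ^^ n)"
proof (induction n)
  case (Suc n)
  then show ?case
    using continuous_on_compose[OF Suc.IH continuous_on_subset[OF assms subset_UNIV]] by simp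
qed (simp add: id_def)

lemma funpow_induced_mono:
  fixes F :: "'a :: metric_space \<Rightarrow> 'a hyperspace"
  assumes "continuous_on UNIV F" "set_of B \<subseteq> set_of C"
  shows "set_of ((induced F ^^ n) B) \<subseteq> set_of ((induced F ^^ n) C)"
  using assms(2) by (induction n) (auto simp: set_of_induced[OF assms(1)])

section \<open>Stability of attracting fixed points\<close>

text \<open>The basin of an attractor enters the proof only through a ball around the attractor.\<close>

locale attracted_ball =
  fixes F :: "'a :: metric_space \<Rightarrow> 'a hyperspace" and A :: "'a hyperspace" and r :: real
  assumes cont: "continuous_on UNIV F"
    and fixed: "induced F A = A"
    and r_pos: "r > 0"
    and attracted: "\<And>B. dist B A < r \<Longrightarrow> (\<lambda>n. (induced F ^^ n) B) \<longlonglongrightarrow> A"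
begin

abbreviation f where "f \<equiv> induced F"

lemma funpow_fixed [simp]: "(f ^^ n) A = A"
  by (induction n) (auto simp: fixed)

lemma tendsto_funpow: "(B \<longlongrightarrow> C) G \<Longrightarrow> ((\<lambda>k. (f ^^ n) (B k)) \<longlongrightarrow> (f ^^ n) C) G"
  using continuous_on_tendsto_compose[OF continuous_on_funpow[OF continuous_on_induced[OF cont]]] by simp

lemma funpow_subset: "set_of B \<subseteq> set_of A \<Longrightarrow> set_of ((f ^^ n) B) \<subseteq> set_of A"
  using funpow_induced_mono[OF cont, of B A n] by simp

lemma funpow_close_upto:
  assumes "B \<longlonglongrightarrow> A" "e > 0"
  shows "\<forall>\<^sub>F k in sequentially. \<forall>n<N. dist ((f ^^ n) (B k)) A < e"
proof -
  have "\<forall>\<^sub>F k in sequentially. \<forall>n\<in>{..<N}. dist ((f ^^ n) (B k)) A < e"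
    using tendstoD[OF tendsto_funpow[OF assms(1)] assms(2)] by (intro eventually_ball_finite) auto
  then show ?thesis by (simp add: Ball_def)
qed

text \<open>One half of stability, in terms of sequences: for a sequence of sets converging to \<open>A\<close> the
  images of the late terms stay, for all times, within a given neighbourhood of \<open>A\<close>. The reason is
  that \<open>A\<close> and these terms form a single compact set, attracted to \<open>A\<close>, that dominates them all.\<close>

lemma outer_stable:
  assumes "B \<longlonglongrightarrow> A" "e > 0"
  shows "\<forall>\<^sub>F k in sequentially. \<forall>n. \<forall>b\<in>set_of ((f ^^ n) (B k)). infdist b (set_of A) < e"
proof -
  obtain K where K: "\<And>k. k \<ge> K \<Longrightarrow> dist (B k) A < r / 2"
    using metric_LIMSEQ_D[OF assms(1), of "r / 2"] r_pos by auto
  define C where "C = Hyper (\<Union>D\<in>insert A (range (\<lambda>k. B (k + K))). set_of D)"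
  have "(\<lambda>k. B (k + K)) \<longlonglongrightarrow> A" by (rule LIMSEQ_ignore_initial_segment[OF assms(1)])
  then have "compact (insert A (range (\<lambda>k. B (k + K))))"
    using compactin_sequence_with_limit[of euclidean "\<lambda>k. B (k + K)" A "range (\<lambda>k. B (k + K))"]
    by simp
  then have C: "set_of C = (\<Union>D\<in>insert A (range (\<lambda>k. B (k + K))). set_of D)"
    unfolding C_def by (intro set_of_Hyper compact_Union_hyperspace) auto
  have "dist C A \<le> r / 2"
  proof (rule dist_hyperspace_le)
    fix c assume "c \<in> set_of C"
    then consider "c \<in> set_of A" | k where "c \<in> set_of (B (k + K))" unfolding C by auto
    then show "infdist c (set_of A) \<le> r / 2"
    proof cases
      case 2
      then show ?thesis
        using infdist_le_dist_hyperspace(1)[OF 2, of A] K[of "k + K"] by simp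
    qed (use r_pos in auto)
  next
    fix a assume "a \<in> set_of A"
    then have "a \<in> set_of C" unfolding C by simp
    then show "infdist a (set_of C) \<le> r / 2" using r_pos by simp
  qed
  then have "(\<lambda>n. (f ^^ n) C) \<longlonglongrightarrow> A" using r_pos by (intro attracted) simp
  from metric_LIMSEQ_D[OF this assms(2)]
  obtain N where N: "\<And>n. n \<ge> N \<Longrightarrow> dist ((f ^^ n) C) A < e"
    by blast
  have "\<forall>\<^sub>F k in sequentially. k \<ge> K" by (rule eventually_ge_at_top)
  with funpow_close_upto[OF assms, of N] show ?thesis
  proof eventually_elim
    case (elim k)
    show ?case
    proof (intro allI ballI)
      fix n b assume b: "b \<in> set_of ((f ^^ n) (B k))"
      have "set_of (B k) \<subseteq> set_of C"
        unfolding C using elim(2) by (intro subsetI UN_I[of "B k"]) (auto intro: range_eqI[of _ _ "k - K"])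
      with b have bC: "b \<in> set_of ((f ^^ n) C)"
        using funpow_induced_mono[OF cont] by blast
      show "infdist b (set_of A) < e"
      proof (cases "n < N")
        case True
        with elim(1) infdist_le_dist_hyperspace(1)[OF b, of A] show ?thesis by (meson order_le_less_trans)
      next
        case False
        with N[of n] infdist_le_dist_hyperspace(1)[OF bC, of A] show ?thesis by simp
      qed
    qed
  qed
qed

text \<open>Baire's theorem in the compact hyperspace of \<open>A\<close>: the closed sets \<open>E N\<close>, on which the
  distance to \<open>A\<close> is at most \<open>e\<close> from time \<open>N\<close> on, cover a ball, hence one of them has an interior
  point. The point found in this way may be at a positive distance from \<open>A\<close>.\<close>

lemma uniform_on_small_ball:
  assumes "e > 0"
  obtains B0 \<eta> N where "set_of B0 \<subseteq> set_of A" "\<eta> > 0"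
    "\<And>B n. set_of B \<subseteq> set_of A \<Longrightarrow> dist B B0 < \<eta> \<Longrightarrow> n \<ge> N \<Longrightarrow> dist ((f ^^ n) B) A \<le> e"
proof -
  let ?KA = "{B. set_of B \<subseteq> set_of A}"
  let ?X = "top_of_set ?KA"
  define E where "E N = {B \<in> ?KA. dist B A \<le> r / 2 \<and> (\<forall>n\<ge>N. dist ((f ^^ n) B) A \<le> e)}" for N
  have "\<exists>N. ?X interior_of E N \<noteq> {}"
  proof (rule ccontr)
    assume no: "\<not> ?thesis"
    have cont': "continuous_on UNIV (\<lambda>B. (f ^^ n) B)" for n
      by (rule continuous_on_funpow[OF continuous_on_induced[OF cont]])
    have "closed (cball A (r / 2) \<inter> (\<Inter>n\<in>{N..}. {B. dist ((f ^^ n) B) A \<le> e}))" for N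
      by (intro closed_Int closed_cball closed_INT ballI closed_Collect_le continuous_on_dist
          cont' continuous_on_const)
    moreover have "E N = ?KA \<inter> (cball A (r / 2) \<inter> (\<Inter>n\<in>{N..}. {B. dist ((f ^^ n) B) A \<le> e}))" for N
      by (auto simp: E_def dist_commute)
    ultimately have clo: "closedin ?X (E N)" for N
      unfolding closedin_closed by blast
    have "compact_space ?X"
      using compact_hyperspace_within[OF compact_set_of[of A]] by (simp add: compact_space_subtopology)
    then have "locally_compact_space ?X \<and> regular_space ?X"
      by (simp add: compact_imp_locally_compact_space metrizable_imp_regular_space
          metrizable_space_subtopology metrizable_space_euclidean)
    then have "?X interior_of \<Union>(range E) = {}"
      using clo no by (intro Baire_category_alt) auto
    moreover have "A \<in> ?X interior_of \<Union>(range E)"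
      unfolding interior_of_def
    proof (rule CollectI, intro exI conjI)
      show "openin ?X (?KA \<inter> ball A (r / 2))" by (simp add: openin_open_Int)
      show "A \<in> ?KA \<inter> ball A (r / 2)" using r_pos by simp
      show "?KA \<inter> ball A (r / 2) \<subseteq> \<Union>(range E)"
      proof
        fix B assume B: "B \<in> ?KA \<inter> ball A (r / 2)"
        then have BA: "dist B A < r / 2" by (simp add: dist_commute)
        then have "(\<lambda>n. (f ^^ n) B) \<longlonglongrightarrow> A" using r_pos by (intro attracted) simp
        from metric_LIMSEQ_D[OF this assms]
        obtain N where "\<forall>n\<ge>N. dist ((f ^^ n) B) A < e"
          by blast
        with B BA have "B \<in> E N" unfolding E_def by (auto intro: less_imp_le)
        then show "B \<in> \<Union>(range E)" by blast
      qed
    qed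
    ultimately show False by simp
  qed
  then obtain N B0 T where T: "openin ?X T" "B0 \<in> T" "T \<subseteq> E N"
    unfolding interior_of_def by blast
  then obtain \<eta> where "\<eta> > 0" "ball B0 \<eta> \<inter> ?KA \<subseteq> T"
    unfolding openin_contains_ball by blast
  with T show thesis
    by (intro that[of B0 \<eta> N]) (auto simp: E_def dist_commute subset_iff)
qed

text \<open>Monotonicity transports the uniform estimate from the ball around \<open>B0\<close> to a ball around \<open>A\<close>:
  a subset \<open>B\<close> of \<open>A\<close> that nearly fills \<open>A\<close> has points near every point of \<open>B0\<close>, and
  these form a subset \<open>K\<close> of \<open>B\<close> close to \<open>B0\<close>.\<close>

lemma inner_stable:
  assumes "e > 0"
  obtains \<delta> where "\<delta> > 0"
    "\<And>B n. set_of B \<subseteq> set_of A \<Longrightarrow> dist B A < \<delta> \<Longrightarrow> dist ((f ^^ n) B) A \<le> e"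
proof -
  obtain B0 \<eta> N where B0: "set_of B0 \<subseteq> set_of A" "\<eta> > 0"
    "\<And>B n. set_of B \<subseteq> set_of A \<Longrightarrow> dist B B0 < \<eta> \<Longrightarrow> n \<ge> N \<Longrightarrow> dist ((f ^^ n) B) A \<le> e"
    using uniform_on_small_ball[OF assms] by blast
  have "((\<lambda>B. B) \<longlongrightarrow> A) (nhds A)" by (rule filterlim_ident)
  from tendstoD[OF tendsto_funpow[OF this] assms]
  have "\<forall>\<^sub>F B in nhds A. \<forall>n\<in>{..<N}. dist ((f ^^ n) B) A < e"
    by (intro eventually_ball_finite) auto
  then obtain d where d: "d > 0" "\<And>B n. dist B A < d \<Longrightarrow> n < N \<Longrightarrow> dist ((f ^^ n) B) A < e"
    unfolding eventually_nhds_metric by auto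
  show thesis
  proof (rule that[of "min d (\<eta> / 2)"])
    fix B n assume B: "set_of B \<subseteq> set_of A" "dist B A < min d (\<eta> / 2)"
    show "dist ((f ^^ n) B) A \<le> e"
    proof (cases "n < N")
      case True
      then show ?thesis using d(2)[of B n] B(2) by simp
    next
      case False
      define K where "K = {b \<in> set_of B. infdist b (set_of B0) \<le> \<eta> / 2}"
      have K: "\<exists>b\<in>K. dist c b < \<eta> / 2" if c: "c \<in> set_of B0" for c
      proof -
        obtain b where "b \<in> set_of B" "dist c b < \<eta> / 2"
          using dist_hyperspace_lessD'[of B A "\<eta> / 2" c] B(2) subsetD[OF B0(1) c] by (metis min_less_iff_conj)
        then show ?thesis
          using c infdist_le2[of c "set_of B0" b "\<eta> / 2"]
          by (auto simp: K_def dist_commute intro!: bexI[of _ b])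
      qed
      have "closed {b. infdist b (set_of B0) \<le> \<eta> / 2}"
        by (intro closed_Collect_le continuous_intros)
      then have "compact K"
        unfolding K_def Collect_conj_eq by auto
      moreover have "K \<noteq> {}" using K set_of_nonempty[of B0] by blast
      ultimately have HK: "set_of (Hyper K) = K" by (intro set_of_Hyper)
      have KB: "set_of (Hyper K) \<subseteq> set_of B" unfolding HK by (auto simp: K_def)
      have "dist (Hyper K) B0 \<le> \<eta> / 2"
      proof (rule dist_hyperspace_le)
        fix b assume "b \<in> set_of (Hyper K)"
        then show "infdist b (set_of B0) \<le> \<eta> / 2" unfolding HK by (simp add: K_def)
      next
        fix c assume "c \<in> set_of B0"
        then obtain b where "b \<in> K" "dist c b < \<eta> / 2" using K by blast
        then show "infdist c (set_of (Hyper K)) \<le> \<eta> / 2" unfolding HK by (intro infdist_le2[of b]) auto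
      qed
      then have "dist ((f ^^ n) (Hyper K)) A \<le> e"
        using False KB B(1) B0(2) by (intro B0(3)) auto
      moreover have "dist ((f ^^ n) B) A \<le> dist ((f ^^ n) (Hyper K)) A"
        by (intro dist_hyperspace_antimono funpow_induced_mono[OF cont] funpow_subset KB B(1))
      ultimately show ?thesis by simp
    qed
  qed (use d(1) B0(2) in auto)
qed

text \<open>If no \<open>N\<close> worked, counterexamples \<open>C N\<close> would accumulate at some \<open>L\<close> in the closed ball.
  The orbit of \<open>L\<close> enters the region where \<open>inner_stable\<close> applies; so do, at the same time, the
  orbits of the \<open>C N\<close> close to \<open>L\<close>, and they can never get back to distance \<open>\<rho>\<close>.\<close>

lemma uniform_return:
  assumes "0 < \<rho>" "\<rho> < r"
  obtains N where "N > 0"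
    "\<And>C. set_of C \<subseteq> set_of A \<Longrightarrow> dist C A \<le> \<rho> \<Longrightarrow> dist ((f ^^ N) C) A < \<rho>"
proof -
  have "\<exists>N. \<forall>C. set_of C \<subseteq> set_of A \<longrightarrow> dist C A \<le> \<rho> \<longrightarrow> dist ((f ^^ Suc N) C) A < \<rho>"
  proof (rule ccontr)
    assume "\<not> ?thesis"
    then obtain C where C: "\<And>N. set_of (C N) \<subseteq> set_of A" "\<And>N. dist (C N) A \<le> \<rho>"
      "\<And>N. dist ((f ^^ Suc N) (C N)) A \<ge> \<rho>"
      by (metis not_less)
    have "C k \<in> {B. set_of B \<subseteq> set_of A}" for k using C(1) by simp
    then obtain L s where L: "L \<in> {B. set_of B \<subseteq> set_of A}" "strict_mono s" "(C \<circ> s) \<longlonglongrightarrow> L"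
      by (rule compact_subsequenceE[OF compact_hyperspace_within[OF compact_set_of]])
    have "dist L A \<le> \<rho>"
      by (rule tendsto_upperbound[OF tendsto_dist[OF L(3) tendsto_const]]) (auto simp: C(2))
    then have conv: "(\<lambda>n. (f ^^ n) L) \<longlonglongrightarrow> A" using assms(2) by (intro attracted) simp
    obtain \<delta> where \<delta>: "\<delta> > 0"
      "\<And>B n. set_of B \<subseteq> set_of A \<Longrightarrow> dist B A < \<delta> \<Longrightarrow> dist ((f ^^ n) B) A \<le> \<rho> / 2"
      using inner_stable[of "\<rho> / 2"] assms(1) by (metis half_gt_zero)
    obtain n where n: "dist ((f ^^ n) L) A < \<delta>"
      using metric_LIMSEQ_D[OF conv \<delta>(1)] by (meson order_refl)
    have "(\<lambda>i. dist ((f ^^ n) ((C \<circ> s) i)) A) \<longlonglongrightarrow> dist ((f ^^ n) L) A"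
      by (intro tendsto_dist tendsto_funpow L(3) tendsto_const)
    then have "\<forall>\<^sub>F i in sequentially. dist ((f ^^ n) (C (s i))) A < \<delta>"
      using n order_tendstoD(2) by fastforce
    from eventually_happens'[OF sequentially_bot eventually_conj[OF eventually_ge_at_top[of n] this]]
    obtain i where i: "i \<ge> n" "dist ((f ^^ n) (C (s i))) A < \<delta>"
      by blast
    have "n \<le> Suc (s i)" using seq_suble[OF L(2), of i] i(1) by simp
    then have "(f ^^ Suc (s i)) (C (s i)) = (f ^^ (Suc (s i) - n)) ((f ^^ n) (C (s i)))"
      by (metis comp_apply funpow_add le_add_diff_inverse2)
    then have "dist ((f ^^ Suc (s i)) (C (s i))) A \<le> \<rho> / 2"
      using \<delta>(2)[OF funpow_subset[OF C(1)] i(2)] by simp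
    with C(3)[of "s i"] assms(1) show False by linarith
  qed
  then show thesis using that by blast
qed

text \<open>The exit argument: by \<open>uniform_return\<close> a subset of \<open>A\<close> in the closed \<open>\<rho>\<close>-ball
  cannot be outside the open one \<open>N\<close> steps later, and \<open>outer_stable\<close> makes every orbit starting near \<open>A\<close> look like
  an orbit of subsets of \<open>A\<close>.\<close>

lemma stable_fixed_point: "stable f A"
  unfolding stable_def
proof (intro allI impI, rule ccontr)
  fix e :: real assume "e > 0"
  \<comment> \<open>The closed \<open>\<rho>\<close>-ball must be attracted, for \<open>uniform_return\<close>.\<close>
  define \<rho> where "\<rho> = min e (r / 2)"
  have \<rho>: "0 < \<rho>" "\<rho> < r" "\<rho> \<le> e" using \<open>e > 0\<close> r_pos by (auto simp: \<rho>_def)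
  assume neg: "\<not> (\<exists>d>0. \<forall>n y. dist y A < d \<longrightarrow> dist ((f ^^ n) y) A < e)"
  have "\<exists>B n. dist B A < 1 / Suc k \<and> dist ((f ^^ n) B) A \<ge> \<rho>" for k
    using neg \<rho>(3) by (metis not_less of_nat_0_less_iff order_trans zero_less_Suc zero_less_divide_1_iff)
  then obtain B where B: "\<And>k. dist (B k) A < 1 / Suc k"
      and ex: "\<And>k. \<exists>n. dist ((f ^^ n) (B k)) A \<ge> \<rho>"
    by metis
  define m where "m k = (LEAST n. dist ((f ^^ n) (B k)) A \<ge> \<rho>)" for k
  have m: "dist ((f ^^ m k) (B k)) A \<ge> \<rho>" for k
    unfolding m_def using ex by (rule LeastI_ex)
  have less_m: "dist ((f ^^ n) (B k)) A < \<rho>" if "n < m k" for n k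
    using not_less_Least[OF that[unfolded m_def]] by simp
  have BA: "B \<longlonglongrightarrow> A"
    by (rule iffD2[OF tendsto_dist_iff
          dist_tendsto_0_le[OF LIMSEQ_Suc[OF lim_1_over_n] less_imp_le[OF B]]])
  obtain N where N: "N > 0"
    "\<And>C. set_of C \<subseteq> set_of A \<Longrightarrow> dist C A \<le> \<rho> \<Longrightarrow> dist ((f ^^ N) C) A < \<rho>"
    using uniform_return[OF \<rho>(1,2)] by blast
  \<comment> \<open>The state \<open>N\<close> steps before the first exit; \<open>N > 0\<close> puts it strictly inside the ball.\<close>
  define D where "D k = (f ^^ (m k - N)) (B k)" for k
  \<comment> \<open>By continuity the first exit is eventually late, so the truncated subtraction is harmless.\<close>
  have late: "\<forall>\<^sub>F k in sequentially. N \<le> m k"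
    using funpow_close_upto[OF BA \<rho>(1), of N]
  proof eventually_elim
    case (elim k)
    then show ?case using m[of k] by (meson not_le)
  qed
  have "\<exists>C. set_of C \<subseteq> set_of A \<and>
      (\<forall>e. (\<forall>d\<in>set_of (D k). infdist d (set_of A) \<le> e) \<longrightarrow> dist (D k) C \<le> e)" for k
    using shadow_in_superset[of A "D k"] by metis
  then obtain C where C: "\<And>k. set_of (C k) \<subseteq> set_of A"
    "\<And>k e. (\<And>d. d \<in> set_of (D k) \<Longrightarrow> infdist d (set_of A) \<le> e) \<Longrightarrow> dist (D k) (C k) \<le> e"
    by metis
  have "C k \<in> {B. set_of B \<subseteq> set_of A}" for k using C(1) by simp
  then obtain L s where L: "L \<in> {B. set_of B \<subseteq> set_of A}" "strict_mono s" "(C \<circ> s) \<longlonglongrightarrow> L"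
    by (rule compact_subsequenceE[OF compact_hyperspace_within[OF compact_set_of]])
  have "(\<lambda>k. dist (D k) (C k)) \<longlonglongrightarrow> 0"
  proof (rule tendstoI)
    fix x :: real assume "x > 0"
    then have "\<forall>\<^sub>F k in sequentially. \<forall>n. \<forall>b\<in>set_of ((f ^^ n) (B k)). infdist b (set_of A) < x / 2"
      by (intro outer_stable[OF BA]) simp
    then show "\<forall>\<^sub>F k in sequentially. dist (dist (D k) (C k)) 0 < x"
    proof eventually_elim
      case (elim k)
      then have "dist (D k) (C k) \<le> x / 2" by (intro C(2)) (auto simp: D_def intro: less_imp_le)
      with \<open>x > 0\<close> show ?case by simp
    qed
  qed
  from LIMSEQ_subseq_LIMSEQ[OF this L(2)]
  have "(\<lambda>i. dist (D (s i)) (C (s i)) + dist (C (s i)) L) \<longlonglongrightarrow> 0 + 0"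
    using L(3) by (intro tendsto_add) (simp_all add: tendsto_dist_iff[symmetric] o_def)
  then have "(\<lambda>i. dist (D (s i)) L) \<longlonglongrightarrow> 0"
    by (intro dist_tendsto_0_le[OF _ dist_triangle]) simp
  then have DL: "(\<lambda>i. D (s i)) \<longlonglongrightarrow> L" by (simp add: tendsto_dist_iff[symmetric])
  have late': "\<forall>\<^sub>F i in sequentially. N \<le> m (s i)"
    using eventually_subseq[OF L(2) late] .
  have "dist L A \<le> \<rho>"
  proof (rule tendsto_upperbound[OF tendsto_dist[OF DL tendsto_const]])
    show "\<forall>\<^sub>F i in sequentially. dist (D (s i)) A \<le> \<rho>"
      using late'
    proof eventually_elim
      case (elim i)
      then show ?case unfolding D_def using N(1) by (intro less_imp_le less_m) simp
    qed
  qed simp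
  moreover have "\<rho> \<le> dist ((f ^^ N) L) A"
  proof (rule tendsto_lowerbound[OF tendsto_dist[OF tendsto_funpow[OF DL] tendsto_const]])
    show "\<forall>\<^sub>F i in sequentially. \<rho> \<le> dist ((f ^^ N) (D (s i))) A"
      using late'
    proof eventually_elim
      case (elim i)
      then have "(f ^^ N) (D (s i)) = (f ^^ m (s i)) (B (s i))"
        unfolding D_def by (metis comp_apply funpow_add le_add_diff_inverse)
      then show ?case using m[of "s i"] by simp
    qed
  qed simp
  ultimately show False using N(2)[of L] L(1) by fastforce
qed

end

lemma attractor_on_stable:
  assumes "continuous_on UNIV F" "attractor_on U F A"
  shows "stable (induced F) A"
proof -
  obtain r where r: "r > 0" "ball A r \<subseteq> U"
    using assms(2) openE unfolding attractor_on_def by metis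
  interpret attracted_ball F A r
  proof
    fix B assume "dist B A < r"
    then have "B \<in> U" using r(2) by (auto simp: dist_commute)
    then show "(\<lambda>n. (induced F ^^ n) B) \<longlonglongrightarrow> A"
      using assms(2) unfolding attractor_on_def by (simp add: tendsto_dist_iff[symmetric])
  qed (use assms r(1) in \<open>auto simp: attractor_on_def\<close>)
  show ?thesis by (rule stable_fixed_point)
qed

theorem theorem1:
  fixes F :: "'a :: metric_space \<Rightarrow> 'a hyperspace" and A :: "'a hyperspace"
  assumes "continuous_on UNIV F"
    and "attractor F A"
  shows "asymptotically_stable (induced F) A
    \<and> (\<forall>U. attractor_on U F A \<longrightarrow> asymptotically_stable_on U (induced F) A)"
proof -
  have "asymptotically_stable_on U (induced F) A" if "attractor_on U F A" for U
    using that attractor_on_stable[OF assms(1) that]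
    unfolding asymptotically_stable_on_def attractive_on_def attractor_on_def by blast
  then show ?thesis
    using assms(2) unfolding attractor_def asymptotically_stable_def attractor_on_def by blast
qed

end
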